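(* If $r\in\mathbb{N}$ and $r>1$, then $GM({}_5\beta)=GM(\beta^{\ast},1)\subsetneq GM(\beta^{\ast},r)$ (the inclusion is proper).
   Context: $\mathbb{N}=\{1,2,3,\dots\}$ and $[x]$ denotes the integer part of $x$. Sequences $a=(a_n)_{n\ge 1}$ are sequences of complex numbers indexed by the positive integers. The class $GM({}_5\beta)$ is the set of all complex sequences $a=(a_n)$ for which there exist a real number $c>1$ and a constant $K(a)$ (both may depend on $a$, but not on $m$) such that for all $m\in\mathbb{N}$ $$\sum_{n=m}^{2m-1}|a_n-a_{n+1}|\le K(a)\Big(|a_m|+\sum_{k=[m/c]}^{[cm]}\frac{|a_k|}{k}\Big).$$ For $r\in\mathbb{N}$, the class $GM(\beta^{\ast},r)$ is the set of all complex sequences $a=(a_n)$ for which there exist a real number $c>1$ and a constant $K(a)$ (both may depend on $a$, but not on $m$) such that for all $m\in\mathbb{N}$ $$\sum_{n=m}^{2m-1}|a_n-a_{n+r}|\le K(a)\,\beta^{\ast}_m,\qquad \beta^{\ast}_m=\sum_{k=m}^{m+r-1}|a_k|+\sum_{k=[m/c]}^{[cm]}\frac{|a_k|}{k}.$$ In the sums starting at $[m/c]$ only indices $k\ge 1$ are taken (i.e. if $[m/c]=0$ the sum starts at $k=1$). *)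

theory Defs
  imports Complex_Main
begin

(* A sequence (a_n) for n >= 1 is a function on nat. The value a 0 occurs in none of the
   conditions below: m >= 1 throughout and the lower summation limit is cut off at 1. *)

definition mean_part :: "(nat \<Rightarrow> complex) \<Rightarrow> real \<Rightarrow> nat \<Rightarrow> real" where
  "mean_part a c m =
     (\<Sum>k = max 1 (nat \<lfloor>real m / c\<rfloor>)..nat \<lfloor>c * real m\<rfloor>. norm (a k) / real k)"

definition beta5 :: "(nat \<Rightarrow> complex) \<Rightarrow> real \<Rightarrow> nat \<Rightarrow> real" where
  "beta5 a c m = norm (a m) + mean_part a c m"

definition beta_star :: "nat \<Rightarrow> (nat \<Rightarrow> complex) \<Rightarrow> real \<Rightarrow> nat \<Rightarrow> real" where
  "beta_star r a c m = (\<Sum>k = m..m + r - 1. norm (a k)) + mean_part a c m"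

definition GM_beta5 :: "(nat \<Rightarrow> complex) set" where
  "GM_beta5 = {a. \<exists>c>1. \<exists>K::real. \<forall>m\<ge>1.
     (\<Sum>n = m..2 * m - 1. norm (a n - a (n + 1))) \<le> K * beta5 a c m}"

(* Meant for r >= 1: for r = 0 the limit m + r - 1 is subject to truncated subtraction. *)
definition GM_beta_star :: "nat \<Rightarrow> (nat \<Rightarrow> complex) set" where
  "GM_beta_star r = {a. \<exists>c>1. \<exists>K::real. \<forall>m\<ge>1.
     (\<Sum>n = m..2 * m - 1. norm (a n - a (n + r))) \<le> K * beta_star r a c m}"

end

theory Submission
  imports Defs
begin

text \<open>
  For the inclusion, applying the defining inequality on the dyadic blocks starting at
  \<open>m\<close>, \<open>2 m\<close>, \<open>4 m\<close>, \dots\ controls the variation of \<open>a\<close> on \<open>{m..<2 ^ s * m}\<close> for every fixed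
  \<open>s\<close>; the starting term of each block is bounded by \<open>|a m|\<close> plus the variation on the
  earlier blocks, and the mean parts are absorbed by enlarging \<open>c\<close>. For \<open>s = r + 1\<close> this
  interval contains all \<open>n + i\<close> with \<open>n < 2 m\<close> and \<open>i < r\<close>, so no small \<open>m\<close> need
  separate treatment. The inclusion is proper because of the indicator sequence of
  the multiples of \<open>r\<close>: it is \<open>r\<close>-periodic and bounded, hence its mean parts are bounded,
  but its variation on \<open>{m..<2 m}\<close> grows linearly in \<open>m\<close>.
\<close>

lemma mean_part_nonneg: "0 \<le> mean_part a c m"
  unfolding mean_part_def by (intro sum_nonneg) auto

lemma beta5_nonneg: "0 \<le> beta5 a c m"
  unfolding beta5_def using mean_part_nonneg[of a c m] by simp

text \<open>The window of indices from \<open>N * m / c\<close> to \<open>c * N * m\<close> lies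
  inside the one from \<open>m / d\<close> to \<open>d * m\<close>, and all summands are
  nonnegative. This is how a larger parameter at \<open>m\<close> absorbs the mean parts of later
  blocks.\<close>

lemma mean_part_scale:
  assumes c: "0 < c" and N: "1 \<le> N" and d: "real N * c \<le> d"
  shows "mean_part a c (N * m) \<le> mean_part a d m"
proof -
  have "1 * c \<le> real N * c" using N c by (intro mult_right_mono) auto
  then have cd: "c \<le> d" using d by simp
  have "real m / d \<le> real m / c" using c cd by (intro divide_left_mono) auto
  also have "\<dots> \<le> real (N * m) / c"
    using N c mult_right_mono[of 1 "real N" "real m"] by (intro divide_right_mono) auto
  finally have lo: "nat \<lfloor>real m / d\<rfloor> \<le> nat \<lfloor>real (N * m) / c\<rfloor>"
    by (intro nat_mono floor_mono)
  have "c * real (N * m) = real N * c * real m" by simp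
  also have "\<dots> \<le> d * real m" using d by (intro mult_right_mono) auto
  finally have hi: "nat \<lfloor>c * real (N * m)\<rfloor> \<le> nat \<lfloor>d * real m\<rfloor>"
    by (intro nat_mono floor_mono)
  show ?thesis
    unfolding mean_part_def using lo hi by (intro sum_mono2) (auto simp: le_max_iff_disj)
qed

lemma norm_diff_le_variation:
  fixes a :: "nat \<Rightarrow> 'a::real_normed_vector"
  assumes "m \<le> n"
  shows "norm (a m - a n) \<le> (\<Sum>k = m..<n. norm (a k - a (k + 1)))"
proof -
  have "a m - a n = (\<Sum>k = m..<n. a k - a (k + 1))"
    using sum_Suc_diff'[OF assms, of "\<lambda>k. - a k"] by simp
  then show ?thesis by (simp add: norm_sum)
qed

lemma variation_dyadic_blocks:
  assumes c: "1 < c" and K: "0 \<le> K"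
    and bound: "\<And>m. 1 \<le> m \<Longrightarrow> (\<Sum>n = m..<2 * m. norm (a n - a (n + 1))) \<le> K * beta5 a c m"
  shows "\<exists>L\<ge>0. \<forall>m\<ge>1. (\<Sum>n = m..<2 ^ s * m. norm (a n - a (n + 1))) \<le> L * beta5 a (2 ^ s * c) m"
proof (induction s)
  case 0
  then show ?case by (auto intro!: exI[of _ 0])
next
  case (Suc s)
  then obtain L where L: "0 \<le> L"
    and IH: "\<And>m. 1 \<le> m \<Longrightarrow>
      (\<Sum>n = m..<2 ^ s * m. norm (a n - a (n + 1))) \<le> L * beta5 a (2 ^ s * c) m"
    by blast
  define C where "C = 2 ^ Suc s * c"
  \<comment> \<open>The blocks before \<open>2 ^ s * m\<close> contribute \<open>L\<close>. On the
    new block, the starting term costs \<open>norm (a m)\<close> plus the earlier variation, and the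
    mean part is added; bounding these three separately gives the factor \<open>2 + L\<close>, which
    the hypothesis multiplies by \<open>K\<close>.\<close>
  have "(\<Sum>n = m..<2 ^ Suc s * m. norm (a n - a (n + 1))) \<le> (L + K * (2 + L)) * beta5 a C m"
    if m: "1 \<le> m" for m
  proof -
    define M where "M = 2 ^ s * m"
    define V where "V = (\<Sum>n = m..<M. norm (a n - a (n + 1)))"
    have mM: "m \<le> M" and M1: "1 \<le> M" using m by (auto simp: M_def)
    \<comment> \<open>The case \<open>N = 1\<close> of scaling: the starting index stays, only the
      parameter doubles.\<close>
    have "mean_part a (2 ^ s * c) (1 * m) \<le> mean_part a C m"
      using c by (intro mean_part_scale) (auto simp: C_def)
    then have "beta5 a (2 ^ s * c) m \<le> beta5 a C m" by (simp add: beta5_def)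
    then have V: "V \<le> L * beta5 a C m"
      unfolding V_def M_def using IH[OF m] L by (meson mult_left_mono order_trans)
    have "norm (a M) \<le> norm (a m) + norm (a m - a M)"
      by (metis norm_minus_commute norm_triangle_sub)
    also have "norm (a m - a M) \<le> V"
      unfolding V_def by (rule norm_diff_le_variation[OF mM])
    finally have aM: "norm (a M) \<le> norm (a m) + V" by simp
    have mean: "mean_part a c M \<le> mean_part a C m"
      unfolding M_def using c by (intro mean_part_scale) (auto simp: C_def)
    have "norm (a m) \<le> beta5 a C m" "mean_part a C m \<le> beta5 a C m"
      using mean_part_nonneg[of a C m] by (auto simp: beta5_def)
    then have "beta5 a c M \<le> (2 + L) * beta5 a C m"
      unfolding beta5_def[of a c] using aM mean V by (simp add: algebra_simps)
    then have "(\<Sum>n = M..<2 * M. norm (a n - a (n + 1))) \<le> K * ((2 + L) * beta5 a C m)"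
      using bound[OF M1] K by (meson mult_left_mono order_trans)
    moreover have "(\<Sum>n = m..<2 * M. norm (a n - a (n + 1)))
        = V + (\<Sum>n = M..<2 * M. norm (a n - a (n + 1)))"
      unfolding V_def using mM by (simp add: sum.atLeastLessThan_concat)
    ultimately show ?thesis
      using V by (simp add: M_def algebra_simps)
  qed
  moreover have "0 \<le> L + K * (2 + L)" using K L by simp
  ultimately show ?case unfolding C_def by blast
qed

lemma beta_star_1: "beta_star 1 = beta5"
  by (intro ext) (simp add: beta_star_def beta5_def)

lemma GM_beta5_eq_GM_beta_star_1: "GM_beta5 = GM_beta_star 1"
  unfolding GM_beta5_def GM_beta_star_def beta_star_1 by simp

lemma beta5_le_beta_star:
  assumes "1 \<le> r"
  shows "beta5 a c m \<le> beta_star r a c m"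
proof -
  have "norm (a m) = (\<Sum>k\<in>{m}. norm (a k))" by simp
  also have "\<dots> \<le> (\<Sum>k = m..m + r - 1. norm (a k))"
    using assms by (intro sum_mono2) auto
  finally show ?thesis by (simp add: beta5_def beta_star_def)
qed

lemma GM_beta5_subset_GM_beta_star:
  assumes r: "1 \<le> r"
  shows "GM_beta5 \<subseteq> GM_beta_star r"
proof
  fix a assume "a \<in> GM_beta5"
  then obtain c K where c: "c > 1"
    and K: "\<And>m. 1 \<le> m \<Longrightarrow> (\<Sum>n = m..2 * m - 1. norm (a n - a (n + 1))) \<le> K * beta5 a c m"
    unfolding GM_beta5_def by blast
  have ivl: "{m..2 * m - 1} = {m..<2 * m}" if "1 \<le> m" for m :: nat using that by auto
  \<comment> \<open>The class does not prescribe the sign of the constant, whereas the induction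
    over blocks multiplies inequalities by it.\<close>
  have "(\<Sum>n = m..<2 * m. norm (a n - a (n + 1))) \<le> \<bar>K\<bar> * beta5 a c m" if "1 \<le> m" for m
  proof -
    have "K * beta5 a c m \<le> \<bar>K\<bar> * beta5 a c m"
      by (intro mult_right_mono beta5_nonneg) simp
    with K[OF that] show ?thesis by (simp only: ivl[OF that])
  qed
  from variation_dyadic_blocks[OF c _ this, of "Suc r"] obtain L where L: "0 \<le> L"
    and var: "\<And>m. 1 \<le> m \<Longrightarrow> (\<Sum>n = m..<2 ^ Suc r * m. norm (a n - a (n + 1)))
      \<le> L * beta5 a (2 ^ Suc r * c) m"
    by auto
  define C where "C = 2 ^ Suc r * c"
  have "(\<Sum>n = m..2 * m - 1. norm (a n - a (n + r))) \<le> (real r * L) * beta_star r a C m"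
    if m: "1 \<le> m" for m
  proof -
    \<comment> \<open>Split \<open>2 ^ Suc r * m\<close> into two equal halves: one exceeds
      \<open>r\<close>, the other is at least \<open>2 * m\<close> because
      \<open>r \<ge> 1\<close>.\<close>
    have "1 * (r + 1) \<le> m * 2 ^ r" using m by (intro mult_mono) (auto simp: Suc_le_eq)
    moreover have "m * 2 \<le> m * 2 ^ r"
      using r power_increasing[of 1 r "2 :: nat"] by simp
    moreover have "2 ^ Suc r * m = m * 2 ^ r + m * 2 ^ r" by simp
    ultimately have le: "2 * m + r \<le> 2 ^ Suc r * m" by presburger
    \<comment> \<open>Telescope each difference into \<open>r\<close> unit steps and swap the sums.
      Each offset \<open>i < r\<close> then yields the variation on a shifted window that still fits
      into the dyadic interval, whence the factor \<open>r\<close>.\<close>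
    have "(\<Sum>n = m..2 * m - 1. norm (a n - a (n + r)))
        \<le> (\<Sum>n = m..<2 * m. \<Sum>i = 0..<r. norm (a (n + i) - a (n + i + 1)))"
      unfolding ivl[OF m]
    proof (rule sum_mono)
      fix n
      have "norm (a n - a (n + r)) \<le> (\<Sum>k = n..<n + r. norm (a k - a (k + 1)))"
        by (rule norm_diff_le_variation) simp
      also have "\<dots> = (\<Sum>i = 0..<r. norm (a (n + i) - a (n + i + 1)))"
        using sum.shift_bounds_nat_ivl[of "\<lambda>k. norm (a k - a (k + 1))" 0 n r]
        by (simp add: add.commute)
      finally show "norm (a n - a (n + r)) \<le> (\<Sum>i = 0..<r. norm (a (n + i) - a (n + i + 1)))" .
    qed
    also have "\<dots> = (\<Sum>i = 0..<r. \<Sum>n = m..<2 * m. norm (a (n + i) - a (n + i + 1)))"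
      by (rule sum.swap)
    also have "\<dots> \<le> (\<Sum>i = 0..<r. L * beta5 a C m)"
    proof (rule sum_mono)
      fix i assume i: "i \<in> {0..<r}"
      have "(\<Sum>n = m..<2 * m. norm (a (n + i) - a (n + i + 1)))
          = (\<Sum>n = m + i..<2 * m + i. norm (a n - a (n + 1)))"
        by (rule sum.shift_bounds_nat_ivl[symmetric])
      also have "\<dots> \<le> (\<Sum>n = m..<2 ^ Suc r * m. norm (a n - a (n + 1)))"
        using i le by (intro sum_mono2) auto
      also have "\<dots> \<le> L * beta5 a C m" unfolding C_def by (rule var[OF m])
      finally show "(\<Sum>n = m..<2 * m. norm (a (n + i) - a (n + i + 1))) \<le> L * beta5 a C m" .
    qed
    also have "\<dots> = (real r * L) * beta5 a C m" by simp
    also have "\<dots> \<le> (real r * L) * beta_star r a C m"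
      using L by (intro mult_left_mono beta5_le_beta_star[OF r]) simp
    finally show ?thesis .
  qed
  moreover have "C > 1"
    unfolding C_def using c one_le_power[of "2 :: real" "Suc r"] less_1_mult'[of c "2 ^ Suc r"]
    by (simp add: mult.commute)
  ultimately show "a \<in> GM_beta_star r" unfolding GM_beta_star_def by blast
qed

text \<open>At most \<open>c * m\<close> terms occur, each at most a constant multiple of
  \<open>1 / m\<close>, so the dependence on \<open>m\<close> cancels.\<close>

lemma mean_part_bounded:
  assumes a: "\<And>k. norm (a k) \<le> 1" and c: "0 < c" and m: "1 \<le> m"
  shows "mean_part a c m \<le> 2 * c * (c + 1)"
proof -
  define lo where "lo = max 1 (nat \<lfloor>real m / c\<rfloor>)"
  define hi where "hi = nat \<lfloor>c * real m\<rfloor>"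
  have lo1: "1 \<le> lo" by (simp add: lo_def)
  \<comment> \<open>A real x is below its floor plus 1, which is at most twice the maximum of 1 and
    that floor, for x \<ge> 0.\<close>
  have "real m / c \<le> 2 * real lo" unfolding lo_def by linarith
  then have lo: "1 / real lo \<le> 2 * c / real m"
    using lo1 c m by (simp add: field_simps)
  have hi: "real hi \<le> c * real m" unfolding hi_def using c by simp
  have "mean_part a c m \<le> (\<Sum>k = lo..hi. 1 / real lo)"
    unfolding mean_part_def lo_def[symmetric] hi_def[symmetric]
    using a lo1 by (intro sum_mono frac_le) auto
  also have "\<dots> = real (card {lo..hi}) * (1 / real lo)" by simp
  also have "\<dots> \<le> real hi * (2 * c / real m)"
    using lo lo1 c by (intro mult_mono) auto
  also have "\<dots> \<le> c * real m * (2 * c / real m)"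
    using hi c by (intro mult_right_mono) auto
  also have "\<dots> \<le> 2 * c * (c + 1)" using m c by (simp add: field_simps)
  finally show ?thesis .
qed

lemma periodic_in_GM_beta_star:
  assumes "\<And>n. a (n + r) = a n"
  shows "a \<in> GM_beta_star r"
proof -
  have "(\<Sum>n = m..2 * m - 1. norm (a n - a (n + r))) \<le> 0 * beta_star r a 2 m" for m
    using assms by simp
  moreover have "(1 :: real) < 2" by simp
  ultimately show ?thesis unfolding GM_beta_star_def by blast
qed

lemma multiples_indicator_notin_GM_beta5:
  assumes r: "1 < r"
  shows "(\<lambda>n. if r dvd n then 1 else 0) \<notin> GM_beta5" (is "?a \<notin> _")
proof
  assume "?a \<in> GM_beta5"
  then obtain c K where c: "c > 1"
    and K: "\<And>m. 1 \<le> m \<Longrightarrow> (\<Sum>n = m..2 * m - 1. norm (?a n - ?a (n + 1))) \<le> K * beta5 ?a c m"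
    unfolding GM_beta5_def by blast
  have le: "real j \<le> \<bar>K\<bar> * (1 + 2 * c * (c + 1))" if j: "1 \<le> j" for j
  proof -
    \<comment> \<open>With this choice the multiples of \<open>r\<close> in
      \<open>{m..<2 * m}\<close> are the \<open>j\<close> numbers \<open>r * i\<close> with
      \<open>j \<le> i < 2 * j\<close>. After each of them the sequence drops from 1 to 0, as
      \<open>r > 1\<close> does not divide \<open>r * i + 1\<close>.\<close>
    define m where "m = r * j"
    have m: "1 \<le> m" using r j by (simp add: m_def)
    have jump: "norm (?a (r * i) - ?a (r * i + 1)) = 1" for i
      using r dvd_add_right_iff[of r "r * i" 1] by auto
    have "real j = (\<Sum>i = j..<2 * j. norm (?a (r * i) - ?a (r * i + 1)))"
      unfolding jump by simp
    also have "\<dots> = (\<Sum>n \<in> (\<lambda>i. r * i) ` {j..<2 * j}. norm (?a n - ?a (n + 1)))"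
      using r by (subst sum.reindex) (auto simp: inj_on_def)
    also have "\<dots> \<le> (\<Sum>n = m..2 * m - 1. norm (?a n - ?a (n + 1)))"
    proof (rule sum_mono2)
      show "(\<lambda>i. r * i) ` {j..<2 * j} \<subseteq> {m..2 * m - 1}"
      proof
        fix n assume "n \<in> (\<lambda>i. r * i) ` {j..<2 * j}"
        then obtain i where i: "n = r * i" "j \<le> i" "i < 2 * j" by fastforce
        have "r * i < r * (2 * j)" using r i by simp
        then have "r * i \<le> 2 * m - 1" unfolding m_def mult.left_commute[of r 2] by linarith
        then show "n \<in> {m..2 * m - 1}" using i by (simp add: m_def)
      qed
    qed auto
    also have "\<dots> \<le> K * beta5 ?a c m" by (rule K[OF m])
    also have "\<dots> \<le> \<bar>K\<bar> * beta5 ?a c m"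
      by (intro mult_right_mono beta5_nonneg) simp
    also have "beta5 ?a c m \<le> 1 + 2 * c * (c + 1)"
      unfolding beta5_def using c m by (intro add_mono mean_part_bounded) auto
    then have "\<bar>K\<bar> * beta5 ?a c m \<le> \<bar>K\<bar> * (1 + 2 * c * (c + 1))"
      by (intro mult_left_mono) auto
    finally show ?thesis .
  qed
  obtain j where j: "\<bar>K\<bar> * (1 + 2 * c * (c + 1)) < real j"
    using reals_Archimedean2 by blast
  have "0 \<le> \<bar>K\<bar> * (1 + 2 * c * (c + 1))" using c by simp
  with j have "1 \<le> j" by linarith
  with le[of j] j show False by simp
qed

theorem corollary1:
  fixes r :: nat
  assumes "r > 1"
  shows "GM_beta5 = GM_beta_star 1 \<and> GM_beta_star 1 \<subset> GM_beta_star r"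
proof -
  have "(\<lambda>n. if r dvd n then 1 else 0) \<in> GM_beta_star r"
    by (rule periodic_in_GM_beta_star) simp
  then show ?thesis
    using assms GM_beta5_subset_GM_beta_star[of r] multiples_indicator_notin_GM_beta5[of r]
    unfolding GM_beta5_eq_GM_beta_star_1[symmetric] by auto
qed

end
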